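(* Let $R$ be a topological ring and let $X$ be a semitopological $R$-module which is not a topological $R$-module. Then the free semitopological $R$-module $M_R(X)$ over (the underlying topological space of) $X$ is not a topological $R$-module.
   Context: All topological spaces are Tychonoff. A topological ring is a unital ring (not necessarily commutative) with a Hausdorff topology making addition and multiplication jointly continuous. A semitopological (resp. topological) $R$-module is a unital left $R$-module $M$ endowed with a Hausdorff topology making $M$ an Abelian topological group and making the multiplication $R\times M\to M$ separately (resp. jointly) continuous. For a topological space $X$, a free semitopological $R$-module over $X$ is a pair $(M_R(X),i_X)$ consisting of a semitopological $R$-module $M_R(X)$ and a continuous map $i_X:X\to M_R(X)$ such that for any continuous map $f:X\to Y$ to a semitopological $R$-module $Y$ there exists a unique continuous $R$-linear map $\bar f:M_R(X)\to Y$ with $f=\bar f\circ i_X$. It exists and is unique up to isomorphism. *)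

theory Defs
  imports "HOL-Analysis.Analysis" "HOL-Algebra.Module"
begin

section \<open>Topological rings and their modules\<close>

text \<open>
  Algebraic structures are carrier-based records of HOL-Algebra; a topology on such a structure is
  a separate abstract topology whose underlying set is the carrier. Hausdorff topological groups are
  Tychonoff, so for rings and modules the Tychonoff property need not be assumed.
\<close>

definition topological_abelian_group :: "('b, 'k) ring_scheme \<Rightarrow> 'b topology \<Rightarrow> bool" where
  "topological_abelian_group G T \<longleftrightarrow>
     abelian_group G \<and> topspace T = carrier G \<and> Hausdorff_space T \<and>
     continuous_map (prod_topology T T) T (\<lambda>(x, y). x \<oplus>\<^bsub>G\<^esub> y) \<and>
     continuous_map T T (\<lambda>x. \<ominus>\<^bsub>G\<^esub> x)"

text \<open>Continuity of negation follows from that of multiplication by \<open>- 1\<close>.\<close>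

definition topological_ring :: "('a, 'k) ring_scheme \<Rightarrow> 'a topology \<Rightarrow> bool" where
  "topological_ring R T \<longleftrightarrow>
     ring R \<and> topspace T = carrier R \<and> Hausdorff_space T \<and>
     continuous_map (prod_topology T T) T (\<lambda>(x, y). x \<oplus>\<^bsub>R\<^esub> y) \<and>
     continuous_map (prod_topology T T) T (\<lambda>(x, y). x \<otimes>\<^bsub>R\<^esub> y)"

text \<open>
  The locale \<open>module\<close> of HOL-Algebra requires a commutative ring of scalars. The fields \<open>mult\<close> and
  \<open>one\<close> of the record \<open>M\<close> are irrelevant.
\<close>

locale left_module = R?: ring R + M?: abelian_group M
  for R (structure) and M (structure) +
  assumes smult_closed [simp, intro]:
      "\<lbrakk>a \<in> carrier R; x \<in> carrier M\<rbrakk> \<Longrightarrow> a \<odot>\<^bsub>M\<^esub> x \<in> carrier M"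
    and smult_l_distr:
      "\<lbrakk>a \<in> carrier R; b \<in> carrier R; x \<in> carrier M\<rbrakk> \<Longrightarrow>
       (a \<oplus>\<^bsub>R\<^esub> b) \<odot>\<^bsub>M\<^esub> x = a \<odot>\<^bsub>M\<^esub> x \<oplus>\<^bsub>M\<^esub> b \<odot>\<^bsub>M\<^esub> x"
    and smult_r_distr:
      "\<lbrakk>a \<in> carrier R; x \<in> carrier M; y \<in> carrier M\<rbrakk> \<Longrightarrow>
       a \<odot>\<^bsub>M\<^esub> (x \<oplus>\<^bsub>M\<^esub> y) = a \<odot>\<^bsub>M\<^esub> x \<oplus>\<^bsub>M\<^esub> a \<odot>\<^bsub>M\<^esub> y"
    and smult_assoc:
      "\<lbrakk>a \<in> carrier R; b \<in> carrier R; x \<in> carrier M\<rbrakk> \<Longrightarrow>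
       (a \<otimes>\<^bsub>R\<^esub> b) \<odot>\<^bsub>M\<^esub> x = a \<odot>\<^bsub>M\<^esub> (b \<odot>\<^bsub>M\<^esub> x)"
    and smult_one [simp]: "x \<in> carrier M \<Longrightarrow> \<one>\<^bsub>R\<^esub> \<odot>\<^bsub>M\<^esub> x = x"

definition semitopological_module ::
  "'a ring \<Rightarrow> 'a topology \<Rightarrow> ('a, 'b) module \<Rightarrow> 'b topology \<Rightarrow> bool" where
  "semitopological_module R TR M TM \<longleftrightarrow>
     left_module R M \<and> topological_abelian_group M TM \<and>
     (\<forall>r\<in>carrier R. continuous_map TM TM (\<lambda>x. r \<odot>\<^bsub>M\<^esub> x)) \<and>
     (\<forall>x\<in>carrier M. continuous_map TR TM (\<lambda>r. r \<odot>\<^bsub>M\<^esub> x))"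

definition topological_module ::
  "'a ring \<Rightarrow> 'a topology \<Rightarrow> ('a, 'b) module \<Rightarrow> 'b topology \<Rightarrow> bool" where
  "topological_module R TR M TM \<longleftrightarrow>
     left_module R M \<and> topological_abelian_group M TM \<and>
     continuous_map (prod_topology TR TM) TM (\<lambda>(r, x). r \<odot>\<^bsub>M\<^esub> x)"

definition left_module_hom :: "'a ring \<Rightarrow> ('a, 'b) module \<Rightarrow> ('a, 'c) module \<Rightarrow> ('b \<Rightarrow> 'c) set" where
  "left_module_hom R M N =
     {g \<in> carrier M \<rightarrow> carrier N.
        (\<forall>x\<in>carrier M. \<forall>y\<in>carrier M. g (x \<oplus>\<^bsub>M\<^esub> y) = g x \<oplus>\<^bsub>N\<^esub> g y) \<and>
        (\<forall>r\<in>carrier R. \<forall>x\<in>carrier M. g (r \<odot>\<^bsub>M\<^esub> x) = r \<odot>\<^bsub>N\<^esub> g x)}"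


section \<open>Free semitopological modules\<close>

text \<open>
  The universal property of \<open>i : X \<rightarrow> M\<close> with respect to all semitopological modules whose elements
  have type \<open>'c\<close>. Maps out of \<open>M\<close> are made extensional so that uniqueness refers to their values on
  the carrier only.
\<close>

definition universal_wrt ::
  "'c itself \<Rightarrow> 'a ring \<Rightarrow> 'a topology \<Rightarrow> 'x topology \<Rightarrow>
     ('a, 'm) module \<Rightarrow> 'm topology \<Rightarrow> ('x \<Rightarrow> 'm) \<Rightarrow> bool" where
  "universal_wrt (_ :: 'c itself) R TR X M TM i \<longleftrightarrow>
     (\<forall>(Y :: ('a, 'c) module) TY f.
        semitopological_module R TR Y TY \<and> continuous_map X TY f \<longrightarrow>
        (\<exists>!g. g \<in> extensional (carrier M) \<and> g \<in> left_module_hom R M Y \<and>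
              continuous_map TM TY g \<and> (\<forall>x\<in>topspace X. g (i x) = f x)))"

text \<open>
  HOL cannot quantify over the type \<open>'c\<close> inside a definition. It suffices to test the universal
  property against modules with elements of the type of \<open>M\<close> itself and of type \<open>('a \<times> 'x) list\<close>;
  the latter contains the formal linear combinations of points of \<open>X\<close> and hence, up to isomorphism,
  every module generated by an image of \<open>X\<close>. Theorem \<open>free_semitopological_module_universal\<close> below
  shows that the universal property then holds with respect to every type, and
  \<open>free_semitopological_module_exists\<close> that such modules exist.
\<close>

definition free_semitopological_module ::
  "'a ring \<Rightarrow> 'a topology \<Rightarrow> 'x topology \<Rightarrow>
     ('a, 'm) module \<Rightarrow> 'm topology \<Rightarrow> ('x \<Rightarrow> 'm) \<Rightarrow> bool" where
  "free_semitopological_module R TR X M TM i \<longleftrightarrow>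
     semitopological_module R TR M TM \<and> continuous_map X TM i \<and>
     universal_wrt TYPE('m) R TR X M TM i \<and>
     universal_wrt TYPE(('a \<times> 'x) list) R TR X M TM i"

subsection \<open>Submodules and linear combinations\<close>

lemma left_moduleD:
  assumes "left_module R M" shows "ring R" "abelian_group M"
  using assms unfolding left_module_def by auto

lemma left_module_smult_zero:
  assumes "left_module R M" "a \<in> carrier R" shows "a \<odot>\<^bsub>M\<^esub> \<zero>\<^bsub>M\<^esub> = \<zero>\<^bsub>M\<^esub>"
proof -
  interpret left_module R M by fact
  have "a \<odot>\<^bsub>M\<^esub> \<zero>\<^bsub>M\<^esub> \<oplus>\<^bsub>M\<^esub> a \<odot>\<^bsub>M\<^esub> \<zero>\<^bsub>M\<^esub> = a \<odot>\<^bsub>M\<^esub> \<zero>\<^bsub>M\<^esub>"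
    using smult_r_distr[of a "\<zero>\<^bsub>M\<^esub>" "\<zero>\<^bsub>M\<^esub>"] assms by simp
  then show ?thesis
    using assms(2) by (metis M.add.l_cancel_one' M.zero_closed smult_closed)
qed

lemma left_module_zero_smult:
  assumes "left_module R M" "x \<in> carrier M" shows "\<zero>\<^bsub>R\<^esub> \<odot>\<^bsub>M\<^esub> x = \<zero>\<^bsub>M\<^esub>"
proof -
  interpret left_module R M by fact
  have "\<zero>\<^bsub>R\<^esub> \<odot>\<^bsub>M\<^esub> x \<oplus>\<^bsub>M\<^esub> \<zero>\<^bsub>R\<^esub> \<odot>\<^bsub>M\<^esub> x = \<zero>\<^bsub>R\<^esub> \<odot>\<^bsub>M\<^esub> x"
    using smult_l_distr[of "\<zero>\<^bsub>R\<^esub>" "\<zero>\<^bsub>R\<^esub>" x] assms by simp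
  then show ?thesis
    using assms(2) by (metis M.add.l_cancel_one' R.zero_closed smult_closed)
qed

lemma left_module_neg:
  assumes "left_module R M" "x \<in> carrier M" shows "(\<ominus>\<^bsub>R\<^esub> \<one>\<^bsub>R\<^esub>) \<odot>\<^bsub>M\<^esub> x = \<ominus>\<^bsub>M\<^esub> x"
proof -
  interpret left_module R M by fact
  have "(\<ominus>\<^bsub>R\<^esub> \<one>\<^bsub>R\<^esub>) \<odot>\<^bsub>M\<^esub> x \<oplus>\<^bsub>M\<^esub> x = \<zero>\<^bsub>M\<^esub>"
    using smult_l_distr[of "\<ominus>\<^bsub>R\<^esub> \<one>\<^bsub>R\<^esub>" "\<one>\<^bsub>R\<^esub>" x] assms left_module_zero_smult[OF assms]
    by (simp add: R.l_neg)
  then show ?thesis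
    using assms(2) by (metis M.minus_equality R.add.inv_closed R.one_closed smult_closed)
qed

lemma left_module_hom_comp:
  assumes "g \<in> left_module_hom R M N" "h \<in> left_module_hom R N P"
  shows "h \<circ> g \<in> left_module_hom R M P"
  using assms by (simp add: left_module_hom_def Pi_iff)

lemma left_module_hom_restrict:
  assumes "g \<in> left_module_hom R M N" "left_module R M"
  shows "restrict g (carrier M) \<in> left_module_hom R M N"
proof -
  interpret left_module R M by fact
  show ?thesis using assms(1) by (simp add: left_module_hom_def Pi_iff)
qed

definition is_submodule :: "'a ring \<Rightarrow> ('a, 'b) module \<Rightarrow> 'b set \<Rightarrow> bool" where
  "is_submodule R M S \<longleftrightarrow> S \<subseteq> carrier M \<and> \<zero>\<^bsub>M\<^esub> \<in> S \<and>
     (\<forall>x\<in>S. \<forall>y\<in>S. x \<oplus>\<^bsub>M\<^esub> y \<in> S) \<and> (\<forall>r\<in>carrier R. \<forall>x\<in>S. r \<odot>\<^bsub>M\<^esub> x \<in> S)"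

text \<open>The module structure on \<open>C\<close> making \<open>e\<close> an isomorphism onto a submodule of \<open>M\<close>.\<close>

definition pullback_module :: "'c set \<Rightarrow> ('c \<Rightarrow> 'b) \<Rightarrow> ('a, 'b) module \<Rightarrow> ('a, 'c) module" where
  "pullback_module C e M =
     \<lparr>carrier = C, mult = (\<lambda>_ _. undefined), one = undefined,
      zero = inv_into C e \<zero>\<^bsub>M\<^esub>, add = (\<lambda>u v. inv_into C e (e u \<oplus>\<^bsub>M\<^esub> e v)),
      smult = (\<lambda>r u. inv_into C e (r \<odot>\<^bsub>M\<^esub> e u))\<rparr>"

lemma continuous_map_add:
  assumes "topological_abelian_group G T" "continuous_map Z T f" "continuous_map Z T g"
  shows "continuous_map Z T (\<lambda>z. f z \<oplus>\<^bsub>G\<^esub> g z)"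
proof -
  have 1: "continuous_map (prod_topology T T) T (\<lambda>(x, y). x \<oplus>\<^bsub>G\<^esub> y)"
    using assms(1) by (simp add: topological_abelian_group_def)
  have 2: "continuous_map Z (prod_topology T T) (\<lambda>z. (f z, g z))"
    using assms by (simp add: continuous_map_paired)
  show ?thesis using continuous_map_compose[OF 2 1] by (simp add: o_def)
qed

lemma pullback_semitopological_module:
  fixes e :: "'c \<Rightarrow> 'b"
  assumes R: "topspace TR = carrier R"
    and M: "semitopological_module R TR M TM"
    and inj: "inj_on e C" and sub: "is_submodule R M (e ` C)"
  defines "N \<equiv> pullback_module C e M" and "TN \<equiv> pullback_topology C e TM"
  shows "semitopological_module R TR N TN" "e \<in> left_module_hom R N M" "continuous_map TN TM e"
proof -
  have lm: "left_module R M" and tg: "topological_abelian_group M TM"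
    and sc1: "\<And>r. r \<in> carrier R \<Longrightarrow> continuous_map TM TM (\<lambda>x. r \<odot>\<^bsub>M\<^esub> x)"
    and sc2: "\<And>x. x \<in> carrier M \<Longrightarrow> continuous_map TR TM (\<lambda>r. r \<odot>\<^bsub>M\<^esub> x)"
    using M by (auto simp: semitopological_module_def)
  interpret left_module R M by fact
  have ts: "topspace TM = carrier M" and haus: "Hausdorff_space TM"
    and cneg: "continuous_map TM TM (\<lambda>x. \<ominus>\<^bsub>M\<^esub> x)"
    using tg by (auto simp: topological_abelian_group_def)
  have eC: "\<And>u. u \<in> C \<Longrightarrow> e u \<in> carrier M" using sub by (auto simp: is_submodule_def)
  have [simp]: "carrier N = C" by (simp add: N_def pullback_module_def)
  have z: "\<zero>\<^bsub>N\<^esub> \<in> C" "e \<zero>\<^bsub>N\<^esub> = \<zero>\<^bsub>M\<^esub>"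
    using sub by (auto simp: N_def pullback_module_def is_submodule_def inv_into_into f_inv_into_f)
  have a: "u \<oplus>\<^bsub>N\<^esub> v \<in> C" "e (u \<oplus>\<^bsub>N\<^esub> v) = e u \<oplus>\<^bsub>M\<^esub> e v" if "u \<in> C" "v \<in> C" for u v
    using sub that
    by (auto simp: N_def pullback_module_def is_submodule_def intro!: inv_into_into f_inv_into_f)
  have s: "r \<odot>\<^bsub>N\<^esub> u \<in> C" "e (r \<odot>\<^bsub>N\<^esub> u) = r \<odot>\<^bsub>M\<^esub> e u" if "r \<in> carrier R" "u \<in> C" for r u
    using sub that
    by (auto simp: N_def pullback_module_def is_submodule_def intro!: inv_into_into f_inv_into_f)
  have eqI: "u = v" if "u \<in> C" "v \<in> C" "e u = e v" for u v
    using inj that by (auto dest: inj_onD)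
  have ag: "abelian_group N"
  proof (rule abelian_groupI)
    fix x assume "x \<in> carrier N"
    then have x: "x \<in> C" by simp
    have "(\<ominus>\<^bsub>R\<^esub> \<one>\<^bsub>R\<^esub>) \<odot>\<^bsub>N\<^esub> x \<oplus>\<^bsub>N\<^esub> x = \<zero>\<^bsub>N\<^esub>"
      by (rule eqI) (simp_all add: x z a s eC left_module_neg[OF lm] M.l_neg)
    then show "\<exists>y\<in>carrier N. y \<oplus>\<^bsub>N\<^esub> x = \<zero>\<^bsub>N\<^esub>" using x s by auto
  next
    fix x y assume "x \<in> carrier N" "y \<in> carrier N"
    then show "x \<oplus>\<^bsub>N\<^esub> y = y \<oplus>\<^bsub>N\<^esub> x" by (intro eqI) (simp_all add: a eC M.a_comm)
  next
    fix x y w assume "x \<in> carrier N" "y \<in> carrier N" "w \<in> carrier N"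
    then show "x \<oplus>\<^bsub>N\<^esub> y \<oplus>\<^bsub>N\<^esub> w = x \<oplus>\<^bsub>N\<^esub> (y \<oplus>\<^bsub>N\<^esub> w)"
      by (intro eqI) (simp_all add: a eC M.a_assoc)
  next
    fix x assume "x \<in> carrier N"
    then show "\<zero>\<^bsub>N\<^esub> \<oplus>\<^bsub>N\<^esub> x = x" by (intro eqI) (simp_all add: a z eC)
  qed (simp_all add: z a)
  interpret N: abelian_group N by fact
  have lmN: "left_module R N"
  proof (intro left_module.intro left_module_axioms.intro, unfold \<open>carrier N = C\<close>)
    show "ring R" by (rule R.ring_axioms)
    show "abelian_group N" by (rule ag)
    fix r x assume r: "r \<in> carrier R" and x: "x \<in> C"
    show "r \<odot>\<^bsub>N\<^esub> x \<in> C" using r x s by simp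
  next
    fix r r' x assume c: "r \<in> carrier R" "r' \<in> carrier R" "x \<in> C"
    show "(r \<oplus>\<^bsub>R\<^esub> r') \<odot>\<^bsub>N\<^esub> x = r \<odot>\<^bsub>N\<^esub> x \<oplus>\<^bsub>N\<^esub> r' \<odot>\<^bsub>N\<^esub> x"
      by (rule eqI) (simp_all add: c s a eC smult_l_distr)
    show "(r \<otimes>\<^bsub>R\<^esub> r') \<odot>\<^bsub>N\<^esub> x = r \<odot>\<^bsub>N\<^esub> (r' \<odot>\<^bsub>N\<^esub> x)"
      by (rule eqI) (simp_all add: c s eC smult_assoc)
  next
    fix r x y assume c: "r \<in> carrier R" "x \<in> C" "y \<in> C"
    show "r \<odot>\<^bsub>N\<^esub> (x \<oplus>\<^bsub>N\<^esub> y) = r \<odot>\<^bsub>N\<^esub> x \<oplus>\<^bsub>N\<^esub> r \<odot>\<^bsub>N\<^esub> y"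
      by (rule eqI) (simp_all add: c s a eC smult_r_distr)
  next
    fix x assume c: "x \<in> C"
    show "\<one>\<^bsub>R\<^esub> \<odot>\<^bsub>N\<^esub> x = x"
      by (rule eqI) (simp_all add: c s eC)
  qed
  have neg: "e (\<ominus>\<^bsub>N\<^esub> u) = \<ominus>\<^bsub>M\<^esub> e u" if "u \<in> C" for u
    using left_module_neg[OF lmN, of u] left_module_neg[OF lm, of "e u"] that eC
      s(2)[of "\<ominus>\<^bsub>R\<^esub> \<one>\<^bsub>R\<^esub>" u] by simp
  have tsN: "topspace TN = C" by (auto simp: TN_def topspace_pullback_topology ts eC)
  have ce: "continuous_map TN TM e"
    unfolding TN_def using continuous_map_pullback[OF continuous_map_id[of TM], of C e] by simp
  have into: "continuous_map Z TN h" if "continuous_map Z TM (\<lambda>z. e (h z))"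
    "\<And>z. z \<in> topspace Z \<Longrightarrow> h z \<in> C" for Z :: "'z topology" and h
    unfolding TN_def using that by (intro continuous_map_pullback') (auto simp: o_def)
  have h: "Hausdorff_space TN"
    using Hausdorff_space_injective_preimage[OF haus ce] inj by (simp add: tsN)
  have cadd: "continuous_map (prod_topology TN TN) TN (\<lambda>(x, y). x \<oplus>\<^bsub>N\<^esub> y)"
  proof (rule into)
    have "continuous_map (prod_topology TN TN) TM (\<lambda>p. e (fst p) \<oplus>\<^bsub>M\<^esub> e (snd p))"
      by (intro continuous_map_add[OF tg] continuous_map_compose[OF _ ce, unfolded o_def]
          continuous_map_fst continuous_map_snd)
    then show "continuous_map (prod_topology TN TN) TM (\<lambda>p. e (case p of (x, y) \<Rightarrow> x \<oplus>\<^bsub>N\<^esub> y))"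
      by (rule continuous_map_eq) (auto simp: a tsN)
  qed (auto simp: a tsN)
  have cn: "continuous_map TN TN (\<lambda>x. \<ominus>\<^bsub>N\<^esub> x)"
  proof (rule into)
    show "continuous_map TN TM (\<lambda>z. e (\<ominus>\<^bsub>N\<^esub> z))"
      by (rule continuous_map_eq[OF continuous_map_compose[OF ce cneg]]) (auto simp: tsN neg)
    show "\<And>z. z \<in> topspace TN \<Longrightarrow> \<ominus>\<^bsub>N\<^esub> z \<in> C"
      using N.a_inv_closed by (simp add: tsN)
  qed
  have c1: "continuous_map TN TN (\<lambda>x. r \<odot>\<^bsub>N\<^esub> x)" if "r \<in> carrier R" for r
    by (rule into, rule continuous_map_eq[OF continuous_map_compose[OF ce sc1[OF that]]])
       (auto simp: tsN s that)
  have c2: "continuous_map TR TN (\<lambda>r. r \<odot>\<^bsub>N\<^esub> x)" if x: "x \<in> C" for x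
    by (rule into, rule continuous_map_eq[OF sc2[OF eC[OF x]]])
       (use x R in \<open>auto simp: s\<close>)
  show "semitopological_module R TR N TN"
    unfolding semitopological_module_def topological_abelian_group_def
    by (intro conjI ballI lmN ag h cadd cn c1 c2) (simp_all only: tsN \<open>carrier N = C\<close>)
  show "e \<in> left_module_hom R N M"
    unfolding left_module_hom_def \<open>carrier N = C\<close>
  proof (intro CollectI conjI ballI funcsetI)
    show "e u \<in> carrier M" if "u \<in> C" for u by (rule eC[OF that])
    show "e (u \<oplus>\<^bsub>N\<^esub> v) = e u \<oplus>\<^bsub>M\<^esub> e v" if "u \<in> C" "v \<in> C" for u v by (rule a(2)[OF that])
    show "e (r \<odot>\<^bsub>N\<^esub> u) = r \<odot>\<^bsub>M\<^esub> e u" if "r \<in> carrier R" "u \<in> C" for r u by (rule s(2)[OF that])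
  qed
  show "continuous_map TN TM e" by (rule ce)
qed

lemma left_module_hom_zero:
  assumes "g \<in> left_module_hom R M N" "left_module R M" "left_module R N"
  shows "g \<zero>\<^bsub>M\<^esub> = \<zero>\<^bsub>N\<^esub>"
proof -
  interpret M: left_module R M by fact
  interpret N: left_module R N by fact
  have z: "\<zero>\<^bsub>M\<^esub> \<in> carrier M" by simp
  have c: "g \<zero>\<^bsub>M\<^esub> \<in> carrier N" using assms(1) z by (simp add: left_module_hom_def Pi_iff)
  have "\<forall>x\<in>carrier M. \<forall>y\<in>carrier M. g (x \<oplus>\<^bsub>M\<^esub> y) = g x \<oplus>\<^bsub>N\<^esub> g y"
    using assms(1) by (simp add: left_module_hom_def)
  from bspec[OF bspec[OF this z] z] have "g \<zero>\<^bsub>M\<^esub> \<oplus>\<^bsub>N\<^esub> g \<zero>\<^bsub>M\<^esub> = g \<zero>\<^bsub>M\<^esub>"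
    unfolding M.M.l_zero[OF z] by (rule sym)
  then show ?thesis by (simp only: N.M.add.l_cancel_one[OF c c])
qed

primrec lincomb :: "('a, 'b) module \<Rightarrow> ('x \<Rightarrow> 'b) \<Rightarrow> ('a \<times> 'x) list \<Rightarrow> 'b" where
  "lincomb M f [] = \<zero>\<^bsub>M\<^esub>"
| "lincomb M f (p # l) = fst p \<odot>\<^bsub>M\<^esub> f (snd p) \<oplus>\<^bsub>M\<^esub> lincomb M f l"

definition formal_combs :: "'a ring \<Rightarrow> 'x topology \<Rightarrow> ('a \<times> 'x) list set" where
  "formal_combs R X = lists (carrier R \<times> topspace X)"

lemma formal_combs_simps [simp]:
  "[] \<in> formal_combs R X"
  "p # l \<in> formal_combs R X \<longleftrightarrow> fst p \<in> carrier R \<and> snd p \<in> topspace X \<and> l \<in> formal_combs R X"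
  "l @ l' \<in> formal_combs R X \<longleftrightarrow> l \<in> formal_combs R X \<and> l' \<in> formal_combs R X"
  by (auto simp: formal_combs_def mem_Times_iff)

lemma lincomb_closed:
  assumes "left_module R M" "f \<in> topspace X \<rightarrow> carrier M" "l \<in> formal_combs R X"
  shows "lincomb M f l \<in> carrier M"
proof -
  interpret left_module R M by fact
  show ?thesis using assms(2,3) by (induction l) (simp_all add: Pi_iff)
qed

lemma lincomb_append:
  assumes "left_module R M" "f \<in> topspace X \<rightarrow> carrier M"
    "l \<in> formal_combs R X" "l' \<in> formal_combs R X"
  shows "lincomb M f (l @ l') = lincomb M f l \<oplus>\<^bsub>M\<^esub> lincomb M f l'"
proof -
  interpret left_module R M by fact
  show ?thesis using assms(2,3) lincomb_closed[OF assms(1,2)] assms(4)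
    by (induction l) (simp_all add: Pi_iff M.a_assoc)
qed

lemma lincomb_smult:
  assumes "left_module R M" "f \<in> topspace X \<rightarrow> carrier M" "l \<in> formal_combs R X" "r \<in> carrier R"
  shows "map (\<lambda>p. (r \<otimes>\<^bsub>R\<^esub> fst p, snd p)) l \<in> formal_combs R X \<and>
    lincomb M f (map (\<lambda>p. (r \<otimes>\<^bsub>R\<^esub> fst p, snd p)) l) = r \<odot>\<^bsub>M\<^esub> lincomb M f l"
proof -
  interpret left_module R M by fact
  show ?thesis using assms(2,3,4) lincomb_closed[OF assms(1,2)]
    by (induction l)
       (simp_all add: Pi_iff left_module_smult_zero[OF assms(1)] smult_r_distr smult_assoc)
qed

lemma lincomb_submodule:
  assumes "left_module R M" "f \<in> topspace X \<rightarrow> carrier M"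
  shows "is_submodule R M (lincomb M f ` formal_combs R X)"
  unfolding is_submodule_def
proof (intro conjI ballI)
  show "lincomb M f ` formal_combs R X \<subseteq> carrier M" using lincomb_closed[OF assms] by blast
  show "\<zero>\<^bsub>M\<^esub> \<in> lincomb M f ` formal_combs R X" by (rule image_eqI[of _ _ "[]"]) simp_all
next
  fix x y assume "x \<in> lincomb M f ` formal_combs R X" "y \<in> lincomb M f ` formal_combs R X"
  then obtain l l' where "l \<in> formal_combs R X" "l' \<in> formal_combs R X"
    "x = lincomb M f l" "y = lincomb M f l'" by blast
  then show "x \<oplus>\<^bsub>M\<^esub> y \<in> lincomb M f ` formal_combs R X"
    using lincomb_append[OF assms] by (intro image_eqI[of _ _ "l @ l'"]) simp_all
next
  fix r x assume "r \<in> carrier R" "x \<in> lincomb M f ` formal_combs R X"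
  then obtain l where "l \<in> formal_combs R X" "x = lincomb M f l" by blast
  then show "r \<odot>\<^bsub>M\<^esub> x \<in> lincomb M f ` formal_combs R X"
    using lincomb_smult[OF assms \<open>l \<in> formal_combs R X\<close> \<open>r \<in> carrier R\<close>]
    by (intro image_eqI[of _ _ "map (\<lambda>p. (r \<otimes>\<^bsub>R\<^esub> fst p, snd p)) l"]) simp_all
qed

lemma lincomb_generator:
  assumes "left_module R M" "f \<in> topspace X \<rightarrow> carrier M" "x \<in> topspace X"
  shows "f x \<in> lincomb M f ` formal_combs R X"
proof -
  interpret left_module R M by fact
  have "f x \<in> carrier M" using assms by blast
  then show ?thesis using assms(3) by (intro image_eqI[of _ _ "[(\<one>\<^bsub>R\<^esub>, x)]"]) simp_all
qed

lemma lincomb_hom: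
  assumes "left_module R M" "left_module R N" "g \<in> left_module_hom R M N"
    "f \<in> topspace X \<rightarrow> carrier M" "\<And>x. x \<in> topspace X \<Longrightarrow> g (f x) = h x" "l \<in> formal_combs R X"
  shows "g (lincomb M f l) = lincomb N h l"
proof -
  interpret M: left_module R M by fact
  have g: "\<And>x y. \<lbrakk>x \<in> carrier M; y \<in> carrier M\<rbrakk> \<Longrightarrow> g (x \<oplus>\<^bsub>M\<^esub> y) = g x \<oplus>\<^bsub>N\<^esub> g y"
    "\<And>r x. \<lbrakk>r \<in> carrier R; x \<in> carrier M\<rbrakk> \<Longrightarrow> g (r \<odot>\<^bsub>M\<^esub> x) = r \<odot>\<^bsub>N\<^esub> g x"
    using assms(3) by (simp_all add: left_module_hom_def)
  have f: "\<And>x. x \<in> topspace X \<Longrightarrow> f x \<in> carrier M" using assms(4) by blast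
  show ?thesis using assms(6)
  proof (induction l)
    case Nil
    then show ?case using left_module_hom_zero[OF assms(3,1,2)] by simp
  next
    case (Cons p l)
    then have "lincomb M f l \<in> carrier M" using lincomb_closed[OF assms(1,4)] by simp
    then show ?case using Cons by (simp add: g f assms(5))
  qed
qed

lemma semitopological_moduleD:
  assumes "semitopological_module R TR M TM"
  shows "left_module R M" "topspace TM = carrier M"
  using assms by (simp_all add: semitopological_module_def topological_abelian_group_def)

lemma continuous_map_into_carrier:
  assumes "semitopological_module R TR M TM" "continuous_map X TM f"
  shows "f \<in> topspace X \<rightarrow> carrier M"
  using continuous_map_funspace[OF assms(2)] semitopological_moduleD(2)[OF assms(1)] by simp

text \<open>
  The submodule generated by a continuous image of \<open>X\<close> is isomorphic to a module whose elements are
  formal linear combinations.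
\<close>

lemma small_image:
  fixes X :: "'x topology" and R :: "'a ring" and Y :: "('a, 'b) module"
  assumes "topspace TR = carrier R" and Y: "semitopological_module R TR Y TY"
    and f: "continuous_map X TY f"
  obtains N :: "('a, ('a \<times> 'x) list) module" and TN e f'
  where "semitopological_module R TR N TN" "e \<in> left_module_hom R N Y" "continuous_map TN TY e"
    "inj_on e (carrier N)" "e ` carrier N = lincomb Y f ` formal_combs R X"
    "continuous_map X TN f'" "\<And>x. x \<in> topspace X \<Longrightarrow> e (f' x) = f x"
proof -
  have lm: "left_module R Y" using semitopological_moduleD[OF Y] by simp
  have fc: "f \<in> topspace X \<rightarrow> carrier Y" by (rule continuous_map_into_carrier[OF Y f])
  define L where "L = formal_combs R X"
  define e where "e = lincomb Y f"
  define C where "C = inv_into L e ` (e ` L)"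
  have eC: "e ` C = e ` L" by (auto simp: C_def image_image f_inv_into_f)
  have inj: "inj_on e C" by (auto simp: C_def inj_on_def f_inv_into_f)
  have sub: "is_submodule R Y (e ` C)"
    unfolding eC unfolding e_def L_def by (rule lincomb_submodule[OF lm fc])
  note N = pullback_semitopological_module[OF assms(1) Y inj sub]
  define f' where "f' x = inv_into L e (f x)" for x
  have fL: "f x \<in> e ` L" if "x \<in> topspace X" for x
    unfolding e_def L_def by (rule lincomb_generator[OF lm fc that])
  have ef: "e (f' x) = f x" if "x \<in> topspace X" for x
    using fL[OF that] by (simp add: f'_def f_inv_into_f)
  have "continuous_map X (pullback_topology C e TY) f'"
  proof (rule continuous_map_pullback')
    show "continuous_map X TY (e \<circ> f')"
      by (rule continuous_map_eq[OF f]) (simp add: ef)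
    show "topspace X \<subseteq> f' -` C" using fL by (auto simp: f'_def C_def)
  qed
  then show thesis
    using that[OF N, of f'] inj eC ef by (simp add: pullback_module_def e_def L_def)
qed

subsection \<open>The universal property for arbitrary types\<close>

lemma universal_wrtI:
  fixes X :: "'x topology" and R :: "'a ring" and M :: "('a, 'm) module"
  assumes R: "topspace TR = carrier R" and M: "semitopological_module R TR M TM"
    and i: "continuous_map X TM i"
    and gen: "lincomb M i ` formal_combs R X = carrier M"
    and ext: "\<And>(Y :: ('a, ('a \<times> 'x) list) module) TY f.
      \<lbrakk>semitopological_module R TR Y TY; continuous_map X TY f\<rbrakk> \<Longrightarrow>
      \<exists>g\<in>left_module_hom R M Y. continuous_map TM TY g \<and> (\<forall>x\<in>topspace X. g (i x) = f x)"
  shows "universal_wrt TYPE('y) R TR X M TM i"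
  unfolding universal_wrt_def
proof (intro allI impI, elim conjE)
  fix Y :: "('a, 'y) module" and TY f
  assume Y: "semitopological_module R TR Y TY" and f: "continuous_map X TY f"
  have lmM: "left_module R M" and tM: "topspace TM = carrier M"
    using semitopological_moduleD[OF M] by simp_all
  have lmY: "left_module R Y" using semitopological_moduleD[OF Y] by simp
  have ic: "i \<in> topspace X \<rightarrow> carrier M" by (rule continuous_map_into_carrier[OF M i])
  obtain N :: "('a, ('a \<times> 'x) list) module" and TN e f'
    where N: "semitopological_module R TR N TN" "e \<in> left_module_hom R N Y" "continuous_map TN TY e"
      and f': "continuous_map X TN f'" "\<And>x. x \<in> topspace X \<Longrightarrow> e (f' x) = f x"
    by (rule small_image[OF R Y f]) blast
  obtain g where g: "g \<in> left_module_hom R M N" "continuous_map TM TN g"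
    "\<And>x. x \<in> topspace X \<Longrightarrow> g (i x) = f' x"
    using ext[OF N(1) f'(1)] by blast
  define h where "h = restrict (e \<circ> g) (carrier M)"
  have hY: "h \<in> left_module_hom R M Y"
    unfolding h_def by (intro left_module_hom_restrict left_module_hom_comp[OF g(1) N(2)] lmM)
  have hc: "continuous_map TM TY h"
    by (rule continuous_map_eq[OF continuous_map_compose[OF g(2) N(3)]]) (simp add: h_def tM)
  have hi: "h (i x) = f x" if "x \<in> topspace X" for x
    using that ic g(3) f'(2) by (auto simp: h_def)
  show "\<exists>!g. g \<in> extensional (carrier M) \<and> g \<in> left_module_hom R M Y \<and>
          continuous_map TM TY g \<and> (\<forall>x\<in>topspace X. g (i x) = f x)"
  proof (rule ex1I[of _ h])
    show "h \<in> extensional (carrier M) \<and> h \<in> left_module_hom R M Y \<and>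
          continuous_map TM TY h \<and> (\<forall>x\<in>topspace X. h (i x) = f x)"
      using hY hc hi by (simp add: h_def)
  next
    fix k
    assume k: "k \<in> extensional (carrier M) \<and> k \<in> left_module_hom R M Y \<and>
          continuous_map TM TY k \<and> (\<forall>x\<in>topspace X. k (i x) = f x)"
    show "k = h"
    proof (rule extensionalityI[of _ "carrier M"])
      show "k \<in> extensional (carrier M)" "h \<in> extensional (carrier M)"
        using k by (simp_all add: h_def)
    next
      fix m assume "m \<in> carrier M"
      then obtain l where l: "l \<in> formal_combs R X" "m = lincomb M i l" using gen by blast
      show "k m = h m"
        using lincomb_hom[OF lmM lmY _ ic _ l(1), of k f] lincomb_hom[OF lmM lmY hY ic hi l(1)] k l(2)
        by simp
    qed
  qed
qed

lemma free_semitopological_module_generated: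
  fixes X :: "'x topology" and R :: "'a ring" and M :: "('a, 'm) module"
  assumes R: "topspace TR = carrier R" and free: "free_semitopological_module R TR X M TM i"
  shows "lincomb M i ` formal_combs R X = carrier M"
proof -
  have M: "semitopological_module R TR M TM" and i: "continuous_map X TM i"
    and uM: "universal_wrt TYPE('m) R TR X M TM i"
    and uL: "universal_wrt TYPE(('a \<times> 'x) list) R TR X M TM i"
    using free by (simp_all add: free_semitopological_module_def)
  have lmM: "left_module R M" and tM: "topspace TM = carrier M"
    using semitopological_moduleD[OF M] by simp_all
  have ic: "i \<in> topspace X \<rightarrow> carrier M" by (rule continuous_map_into_carrier[OF M i])
  obtain N :: "('a, ('a \<times> 'x) list) module" and TN e f'
    where N: "semitopological_module R TR N TN" "e \<in> left_module_hom R N M" "continuous_map TN TM e"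
      and eN: "e ` carrier N = lincomb M i ` formal_combs R X"
      and f': "continuous_map X TN f'" "\<And>x. x \<in> topspace X \<Longrightarrow> e (f' x) = i x"
    by (rule small_image[OF R M i]) blast
  obtain g where g: "g \<in> left_module_hom R M N" "continuous_map TM TN g"
    "\<And>x. x \<in> topspace X \<Longrightarrow> g (i x) = f' x"
    using uL N(1) f'(1) unfolding universal_wrt_def by blast
  let ?P = "\<lambda>g. g \<in> extensional (carrier M) \<and> g \<in> left_module_hom R M M \<and>
          continuous_map TM TM g \<and> (\<forall>x\<in>topspace X. g (i x) = i x)"
  have uniq: "\<exists>!g. ?P g" using uM M i unfolding universal_wrt_def by blast
  have "?P (restrict (e \<circ> g) (carrier M))"
  proof (intro conjI)
    show "restrict (e \<circ> g) (carrier M) \<in> left_module_hom R M M"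
      by (intro left_module_hom_restrict left_module_hom_comp[OF g(1) N(2)] lmM)
    show "continuous_map TM TM (restrict (e \<circ> g) (carrier M))"
      by (rule continuous_map_eq[OF continuous_map_compose[OF g(2) N(3)]]) (simp add: tM)
    show "\<forall>x\<in>topspace X. restrict (e \<circ> g) (carrier M) (i x) = i x"
      using ic g(3) f'(2) by auto
  qed simp
  moreover have "?P (restrict id (carrier M))"
  proof (intro conjI)
    show "restrict id (carrier M) \<in> left_module_hom R M M"
      by (rule left_module_hom_restrict[OF _ lmM]) (simp add: left_module_hom_def)
    show "continuous_map TM TM (restrict id (carrier M))"
      by (rule continuous_map_eq[OF continuous_map_id]) (simp add: tM)
    show "\<forall>x\<in>topspace X. restrict id (carrier M) (i x) = i x" using ic by auto
  qed simp
  ultimately have eq: "restrict (e \<circ> g) (carrier M) = restrict id (carrier M)"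
    using uniq by blast
  have "m \<in> e ` carrier N" if m: "m \<in> carrier M" for m
  proof -
    have "e (g m) = m" using fun_cong[OF eq, of m] m by simp
    moreover have "g m \<in> carrier N" using g(1) m by (auto simp: left_module_hom_def)
    ultimately show ?thesis by (metis image_eqI)
  qed
  then show ?thesis
    using lincomb_closed[OF lmM ic] eN by blast
qed

theorem free_semitopological_module_universal:
  fixes X :: "'x topology" and R :: "'a ring" and M :: "('a, 'm) module"
  assumes "topological_ring R TR" and free: "free_semitopological_module R TR X M TM i"
  shows "universal_wrt TYPE('y) R TR X M TM i"
proof (rule universal_wrtI)
  show R: "topspace TR = carrier R" using assms(1) by (simp add: topological_ring_def)
  show "semitopological_module R TR M TM" "continuous_map X TM i"
    using free by (simp_all add: free_semitopological_module_def)
  show "lincomb M i ` formal_combs R X = carrier M"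
    by (rule free_semitopological_module_generated[OF R free])
next
  fix Y :: "('a, ('a \<times> 'x) list) module" and TY f
  assume Yf: "semitopological_module R TR Y TY" "continuous_map X TY f"
  have "universal_wrt TYPE(('a \<times> 'x) list) R TR X M TM i"
    using free by (simp add: free_semitopological_module_def)
  then have "\<exists>!g. g \<in> extensional (carrier M) \<and> g \<in> left_module_hom R M Y \<and>
          continuous_map TM TY g \<and> (\<forall>x\<in>topspace X. g (i x) = f x)"
    using Yf unfolding universal_wrt_def by simp
  from ex1_implies_ex[OF this]
  show "\<exists>g\<in>left_module_hom R M Y. continuous_map TM TY g \<and> (\<forall>x\<in>topspace X. g (i x) = f x)"
    by blast
qed

subsection \<open>Existence\<close>

definition product_module :: "'j set \<Rightarrow> ('j \<Rightarrow> ('a, 'b) module) \<Rightarrow> ('a, 'j \<Rightarrow> 'b) module" where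
  "product_module I Y =
     \<lparr>carrier = (\<Pi>\<^sub>E j\<in>I. carrier (Y j)), mult = (\<lambda>_ _. undefined), one = undefined,
      zero = (\<lambda>j\<in>I. \<zero>\<^bsub>Y j\<^esub>), add = (\<lambda>u v. \<lambda>j\<in>I. u j \<oplus>\<^bsub>Y j\<^esub> v j),
      smult = (\<lambda>r u. \<lambda>j\<in>I. r \<odot>\<^bsub>Y j\<^esub> u j)\<rparr>"

lemma product_semitopological_module:
  fixes Y :: "'j \<Rightarrow> ('a, 'b) module" and R :: "'a ring"
  assumes R: "ring R" "topspace TR = carrier R"
    and Y: "\<And>j. j \<in> I \<Longrightarrow> semitopological_module R TR (Y j) (TY j)"
  shows "semitopological_module R TR (product_module I Y) (product_topology TY I)"
    and "j \<in> I \<Longrightarrow> (\<lambda>u. u j) \<in> left_module_hom R (product_module I Y) (Y j)"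
proof -
  let ?P = "product_module I Y" and ?T = "product_topology TY I"
  have lm: "left_module R (Y j)" and tg: "topological_abelian_group (Y j) (TY j)"
    and ts: "topspace (TY j) = carrier (Y j)" and haus: "Hausdorff_space (TY j)"
    and cn: "continuous_map (TY j) (TY j) (\<lambda>x. \<ominus>\<^bsub>Y j\<^esub> x)"
    and sc1: "\<And>r. r \<in> carrier R \<Longrightarrow> continuous_map (TY j) (TY j) (\<lambda>x. r \<odot>\<^bsub>Y j\<^esub> x)"
    and sc2: "\<And>x. x \<in> carrier (Y j) \<Longrightarrow> continuous_map TR (TY j) (\<lambda>r. r \<odot>\<^bsub>Y j\<^esub> x)"
    if "j \<in> I" for j
    using Y[OF that] by (simp_all add: semitopological_module_def topological_abelian_group_def)
  note [simp] = abelian_monoid.a_closed[OF abelian_group.axioms(1)[OF left_moduleD(2)[OF lm]]]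
    abelian_monoid.zero_closed[OF abelian_group.axioms(1)[OF left_moduleD(2)[OF lm]]]
    abelian_monoid.l_zero[OF abelian_group.axioms(1)[OF left_moduleD(2)[OF lm]]]
    abelian_group.l_neg[OF left_moduleD(2)[OF lm]]
    abelian_group.a_inv_closed[OF left_moduleD(2)[OF lm]]
    left_module.smult_closed[OF lm] left_module.smult_one[OF lm]
  have car: "carrier ?P = (\<Pi>\<^sub>E j\<in>I. carrier (Y j))" by (simp add: product_module_def)
  have mem: "u j \<in> carrier (Y j)" if "u \<in> carrier ?P" "j \<in> I" for u j
    using that by (auto simp: car)
  have ops: "\<zero>\<^bsub>?P\<^esub> j = \<zero>\<^bsub>Y j\<^esub>" "(u \<oplus>\<^bsub>?P\<^esub> v) j = u j \<oplus>\<^bsub>Y j\<^esub> v j" "(r \<odot>\<^bsub>?P\<^esub> u) j = r \<odot>\<^bsub>Y j\<^esub> u j"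
    if "j \<in> I" for u v r j
    using that by (simp_all add: product_module_def)
  have clo: "\<zero>\<^bsub>?P\<^esub> \<in> carrier ?P"
    "\<And>u v. \<lbrakk>u \<in> carrier ?P; v \<in> carrier ?P\<rbrakk> \<Longrightarrow> u \<oplus>\<^bsub>?P\<^esub> v \<in> carrier ?P"
    "\<And>r u. \<lbrakk>r \<in> carrier R; u \<in> carrier ?P\<rbrakk> \<Longrightarrow> r \<odot>\<^bsub>?P\<^esub> u \<in> carrier ?P"
    by (simp_all add: product_module_def PiE_iff)
  have eqI: "u = v" if "u \<in> carrier ?P" "v \<in> carrier ?P" "\<And>j. j \<in> I \<Longrightarrow> u j = v j" for u v
    using that unfolding car by (rule PiE_ext)
  have neg: "(\<lambda>j\<in>I. \<ominus>\<^bsub>Y j\<^esub> u j) \<in> carrier ?P" "(\<lambda>j\<in>I. \<ominus>\<^bsub>Y j\<^esub> u j) \<oplus>\<^bsub>?P\<^esub> u = \<zero>\<^bsub>?P\<^esub>"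
    if u: "u \<in> carrier ?P" for u
  proof -
    show 1: "(\<lambda>j\<in>I. \<ominus>\<^bsub>Y j\<^esub> u j) \<in> carrier ?P" using u by (simp add: car PiE_iff)
    show "(\<lambda>j\<in>I. \<ominus>\<^bsub>Y j\<^esub> u j) \<oplus>\<^bsub>?P\<^esub> u = \<zero>\<^bsub>?P\<^esub>"
      by (rule eqI) (simp_all add: clo 1 u ops mem)
  qed
  have ag: "abelian_group ?P"
  proof (rule abelian_groupI)
    fix u v w assume c: "u \<in> carrier ?P" "v \<in> carrier ?P" "w \<in> carrier ?P"
    show "u \<oplus>\<^bsub>?P\<^esub> v \<oplus>\<^bsub>?P\<^esub> w = u \<oplus>\<^bsub>?P\<^esub> (v \<oplus>\<^bsub>?P\<^esub> w)"
    proof (rule eqI)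
      fix j assume j: "j \<in> I"
      interpret left_module R "Y j" by (rule lm[OF j])
      show "(u \<oplus>\<^bsub>?P\<^esub> v \<oplus>\<^bsub>?P\<^esub> w) j = (u \<oplus>\<^bsub>?P\<^esub> (v \<oplus>\<^bsub>?P\<^esub> w)) j"
        using c j by (simp add: ops mem M.a_assoc)
    qed (simp_all add: c clo)
  next
    fix u v assume c: "u \<in> carrier ?P" "v \<in> carrier ?P"
    show "u \<oplus>\<^bsub>?P\<^esub> v = v \<oplus>\<^bsub>?P\<^esub> u"
    proof (rule eqI)
      fix j assume j: "j \<in> I"
      interpret left_module R "Y j" by (rule lm[OF j])
      show "(u \<oplus>\<^bsub>?P\<^esub> v) j = (v \<oplus>\<^bsub>?P\<^esub> u) j"
        using c j by (simp add: ops mem M.a_comm)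
    qed (simp_all add: c clo)
  next
    fix u assume c: "u \<in> carrier ?P"
    show "\<zero>\<^bsub>?P\<^esub> \<oplus>\<^bsub>?P\<^esub> u = u"
      by (rule eqI) (simp_all add: c clo ops mem)
    show "\<exists>v\<in>carrier ?P. v \<oplus>\<^bsub>?P\<^esub> u = \<zero>\<^bsub>?P\<^esub>" using neg[OF c] by blast
  qed (simp_all add: clo)
  interpret P: abelian_group ?P by (rule ag)
  have inv: "\<ominus>\<^bsub>?P\<^esub> u = (\<lambda>j\<in>I. \<ominus>\<^bsub>Y j\<^esub> u j)" if "u \<in> carrier ?P" for u
    using P.minus_equality[OF neg(2)[OF that] that neg(1)[OF that]] .
  have lmP: "left_module R ?P"
  proof (intro left_module.intro left_module_axioms.intro)
    fix r s u assume c: "r \<in> carrier R" "s \<in> carrier R" "u \<in> carrier ?P"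
    interpret R: ring R by (rule R(1))
    show "(r \<oplus>\<^bsub>R\<^esub> s) \<odot>\<^bsub>?P\<^esub> u = r \<odot>\<^bsub>?P\<^esub> u \<oplus>\<^bsub>?P\<^esub> s \<odot>\<^bsub>?P\<^esub> u"
      by (rule eqI) (simp_all add: c clo ops mem left_module.smult_l_distr[OF lm])
    show "(r \<otimes>\<^bsub>R\<^esub> s) \<odot>\<^bsub>?P\<^esub> u = r \<odot>\<^bsub>?P\<^esub> (s \<odot>\<^bsub>?P\<^esub> u)"
      by (rule eqI) (simp_all add: c clo ops mem left_module.smult_assoc[OF lm])
  next
    fix r u v assume c: "r \<in> carrier R" "u \<in> carrier ?P" "v \<in> carrier ?P"
    show "r \<odot>\<^bsub>?P\<^esub> (u \<oplus>\<^bsub>?P\<^esub> v) = r \<odot>\<^bsub>?P\<^esub> u \<oplus>\<^bsub>?P\<^esub> r \<odot>\<^bsub>?P\<^esub> v"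
      by (rule eqI) (simp_all add: c clo ops mem left_module.smult_r_distr[OF lm])
  next
    fix u assume c: "u \<in> carrier ?P"
    interpret R: ring R by (rule R(1))
    show "\<one>\<^bsub>R\<^esub> \<odot>\<^bsub>?P\<^esub> u = u"
      by (rule eqI) (simp_all add: c clo ops mem)
  qed (simp_all add: R(1) ag clo)
  have tP: "topspace ?T = carrier ?P"
    by (simp add: car topspace_product_topology ts cong: PiE_cong)
  note topspace_product_topology [simp del]
  have into: "continuous_map Z ?T h"
    if "\<And>z. z \<in> topspace Z \<Longrightarrow> h z \<in> carrier ?P" "\<And>j. j \<in> I \<Longrightarrow> continuous_map Z (TY j) (\<lambda>z. h z j)"
    for Z :: "'z topology" and h
    unfolding continuous_map_componentwise using that by (auto simp: car PiE_def)
  have proj: "continuous_map ?T (TY j) (\<lambda>u. u j)" if "j \<in> I" for j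
    by (rule continuous_map_product_projection[OF that])
  have cadd: "continuous_map (prod_topology ?T ?T) ?T (\<lambda>(u, v). u \<oplus>\<^bsub>?P\<^esub> v)"
  proof (rule into)
    fix j assume j: "j \<in> I"
    have "continuous_map (prod_topology ?T ?T) (TY j) (\<lambda>p. fst p j \<oplus>\<^bsub>Y j\<^esub> snd p j)"
      by (intro continuous_map_add[OF tg[OF j]] continuous_map_compose[OF _ proj[OF j], unfolded o_def]
          continuous_map_fst continuous_map_snd)
    then show "continuous_map (prod_topology ?T ?T) (TY j) (\<lambda>p. (case p of (u, v) \<Rightarrow> u \<oplus>\<^bsub>?P\<^esub> v) j)"
      by (simp add: ops[OF j] case_prod_unfold)
  qed (simp add: case_prod_unfold mem_Times_iff tP clo)
  have cneg: "continuous_map ?T ?T (\<lambda>u. \<ominus>\<^bsub>?P\<^esub> u)"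
  proof (rule into)
    fix j assume j: "j \<in> I"
    show "continuous_map ?T (TY j) (\<lambda>u. (\<ominus>\<^bsub>?P\<^esub> u) j)"
      by (rule continuous_map_eq[OF continuous_map_compose[OF proj[OF j] cn[OF j]]])
         (simp add: tP inv j)
  qed (simp add: tP)
  have c1: "continuous_map ?T ?T (\<lambda>u. r \<odot>\<^bsub>?P\<^esub> u)" if r: "r \<in> carrier R" for r
  proof (rule into)
    fix j assume j: "j \<in> I"
    show "continuous_map ?T (TY j) (\<lambda>u. (r \<odot>\<^bsub>?P\<^esub> u) j)"
      by (rule continuous_map_eq[OF continuous_map_compose[OF proj[OF j] sc1[OF j r]]])
         (simp add: ops j)
  qed (simp add: tP clo r)
  have c2: "continuous_map TR ?T (\<lambda>r. r \<odot>\<^bsub>?P\<^esub> u)" if u: "u \<in> carrier ?P" for u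
  proof (rule into)
    fix j assume j: "j \<in> I"
    show "continuous_map TR (TY j) (\<lambda>r. (r \<odot>\<^bsub>?P\<^esub> u) j)"
      using sc2[OF j mem[OF u j]] by (simp add: ops j)
  qed (simp add: R(2) clo u)
  have "Hausdorff_space ?T"
    using haus by (simp add: Hausdorff_space_product_topology)
  then show "semitopological_module R TR ?P ?T"
    unfolding semitopological_module_def topological_abelian_group_def
    using lmP ag tP cadd cneg c1 c2 by simp
  show "(\<lambda>u. u j) \<in> left_module_hom R ?P (Y j)" if "j \<in> I"
    by (auto simp: left_module_hom_def ops that mem)
qed

theorem free_semitopological_module_exists:
  fixes X :: "'x topology" and R :: "'a ring"
  assumes "topological_ring R TR"
  shows "\<exists>(M :: ('a, ('a \<times> 'x) list) module) TM i. free_semitopological_module R TR X M TM i"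
proof -
  have R: "ring R" "topspace TR = carrier R" using assms by (simp_all add: topological_ring_def)
  define I :: "(('a, ('a \<times> 'x) list) module \<times> ('a \<times> 'x) list topology \<times> ('x \<Rightarrow> ('a \<times> 'x) list)) set"
    where "I = {(Y, TY, f). semitopological_module R TR Y TY \<and> continuous_map X TY f}"
  define P where "P = product_module I fst"
  define TP where "TP = product_topology (\<lambda>j. fst (snd j)) I"
  define d where "d x = (\<lambda>j\<in>I. snd (snd j) x)" for x
  have I: "semitopological_module R TR (fst j) (fst (snd j))"
    "continuous_map X (fst (snd j)) (snd (snd j))" if "j \<in> I" for j
    using that by (auto simp: I_def)
  have P: "semitopological_module R TR P TP"
    unfolding P_def TP_def by (rule product_semitopological_module(1)[OF R I(1)])
  have proj1: "(\<lambda>u. u j) \<in> left_module_hom R P (fst j)" if "j \<in> I" for j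
    unfolding P_def by (rule product_semitopological_module(2)[OF R I(1) that])
  have proj2: "continuous_map TP (fst (snd j)) (\<lambda>u. u j)" if "j \<in> I" for j
    unfolding TP_def by (rule continuous_map_product_projection[OF that])
  have d: "continuous_map X TP d"
    unfolding TP_def continuous_map_componentwise
  proof (intro conjI ballI)
    fix j assume j: "j \<in> I"
    show "continuous_map X (fst (snd j)) (\<lambda>x. d x j)" using I(2)[OF j] j by (simp add: d_def)
  qed (auto simp: d_def)
  obtain M :: "('a, ('a \<times> 'x) list) module" and TM e i
    where M: "semitopological_module R TR M TM" "e \<in> left_module_hom R M P" "continuous_map TM TP e"
      and e: "inj_on e (carrier M)" "e ` carrier M = lincomb P d ` formal_combs R X"
      and i: "continuous_map X TM i" "\<And>x. x \<in> topspace X \<Longrightarrow> e (i x) = d x"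
    by (rule small_image[OF R(2) P d]) blast
  have lm: "left_module R M" "left_module R P"
    using semitopological_moduleD(1)[OF M(1)] semitopological_moduleD(1)[OF P] by simp_all
  have ic: "i \<in> topspace X \<rightarrow> carrier M" by (rule continuous_map_into_carrier[OF M(1) i(1)])
  have gen: "lincomb M i ` formal_combs R X = carrier M"
  proof (intro equalityI subsetI)
    fix m assume m: "m \<in> carrier M"
    then obtain l where l: "l \<in> formal_combs R X" "e m = lincomb P d l" using e(2) by blast
    then have "e m = e (lincomb M i l)" using lincomb_hom[OF lm M(2) ic i(2)] by simp
    then have "m = lincomb M i l" using e(1) m lincomb_closed[OF lm(1) ic l(1)] by (auto dest: inj_onD)
    then show "m \<in> lincomb M i ` formal_combs R X" using l(1) by blast
  qed (use lincomb_closed[OF lm(1) ic] in blast)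
  have ext: "\<exists>g\<in>left_module_hom R M Y. continuous_map TM TY g \<and> (\<forall>x\<in>topspace X. g (i x) = f x)"
    if "semitopological_module R TR Y TY" "continuous_map X TY f"
    for Y :: "('a, ('a \<times> 'x) list) module" and TY f
  proof -
    have j: "(Y, TY, f) \<in> I" using that by (simp add: I_def)
    show ?thesis
    proof (intro bexI conjI ballI)
      show "(\<lambda>u. u (Y, TY, f)) \<circ> e \<in> left_module_hom R M Y"
        using left_module_hom_comp[OF M(2) proj1[OF j]] by simp
      show "continuous_map TM TY ((\<lambda>u. u (Y, TY, f)) \<circ> e)"
        using continuous_map_compose[OF M(3) proj2[OF j]] by simp
      show "((\<lambda>u. u (Y, TY, f)) \<circ> e) (i x) = f x" if "x \<in> topspace X" for x
        using i(2)[OF that] j by (simp add: d_def)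
    qed
  qed
  have "free_semitopological_module R TR X M TM i"
    unfolding free_semitopological_module_def
    using M(1) i(1) universal_wrtI[OF R(2) M(1) i(1) gen ext] by blast
  then show ?thesis by blast
qed

end

theory Submission
  imports Defs
begin

text \<open>
  By the universal property, the identity of \<open>X\<close> extends to a continuous linear map
  \<open>g : M \<rightarrow> X\<close> with \<open>g \<circ> i = id\<close>, so \<open>X\<close> is a retract of \<open>M\<close>. By linearity
  \<open>r \<cdot> x = r \<cdot> g (i x) = g (r \<cdot> i x)\<close>: the multiplication of \<open>X\<close> is the one of \<open>M\<close>,
  preceded by \<open>id \<times> i\<close> and followed by \<open>g\<close>. Joint continuity therefore passes from \<open>M\<close>
  to \<open>X\<close>.
\<close>

text \<open>
  The section \<open>i\<close> is merely continuous, since the canonical map of \<open>X\<close> into its free module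
  is not additive in general; the linearity of \<open>g\<close> alone identifies
  \<open>g (r \<cdot> i x)\<close> with \<open>r \<cdot> x\<close>.
\<close>

lemma topological_module_retract:
  assumes X: "semitopological_module R TR X TX"
    and M: "topological_module R TR M TM"
    and R: "topspace TR = carrier R"
    and i: "continuous_map TX TM i"
    and g: "g \<in> left_module_hom R M X" "continuous_map TM TX g"
    and gi: "\<And>x. x \<in> carrier X \<Longrightarrow> g (i x) = x"
  shows "topological_module R TR X TX"
proof -
  have tX: "topspace TX = carrier X" using semitopological_moduleD(2)[OF X] .
  have tM: "topspace TM = carrier M"
    and mult: "continuous_map (prod_topology TR TM) TM (\<lambda>(r, x). r \<odot>\<^bsub>M\<^esub> x)"
    using M by (simp_all add: topological_module_def topological_abelian_group_def)
  have ic: "i x \<in> carrier M" if "x \<in> carrier X" for x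
    using continuous_map_funspace[OF i] that by (auto simp: tX tM)
  have pair: "continuous_map (prod_topology TR TX) (prod_topology TR TM) (\<lambda>p. (fst p, i (snd p)))"
    by (intro continuous_map_pairedI continuous_map_fst
        continuous_map_compose[OF continuous_map_snd i, unfolded o_def])
  have "continuous_map (prod_topology TR TX) TX (\<lambda>p. g (fst p \<odot>\<^bsub>M\<^esub> i (snd p)))"
    using continuous_map_compose[OF continuous_map_compose[OF pair mult] g(2)]
    by (simp add: o_def)
  then have "continuous_map (prod_topology TR TX) TX (\<lambda>(r, x). r \<odot>\<^bsub>X\<^esub> x)"
    by (rule continuous_map_eq) (use g(1) in \<open>auto simp: left_module_hom_def R tX ic gi\<close>)
  then show ?thesis
    using X by (simp add: semitopological_module_def topological_module_def)
qed

theorem proposition6p2: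
  fixes R :: "'a ring" and TR :: "'a topology"
    and X :: "('a, 'x) module" and TX :: "'x topology"
    and M :: "('a, 'm) module" and TM :: "'m topology" and i :: "'x \<Rightarrow> 'm"
  assumes "topological_ring R TR"
    and "semitopological_module R TR X TX"
    and "\<not> topological_module R TR X TX"
    and "free_semitopological_module R TR TX M TM i"
  shows "\<not> topological_module R TR M TM"
proof
  assume M: "topological_module R TR M TM"
  have R: "topspace TR = carrier R" using assms(1) by (simp add: topological_ring_def)
  have tX: "topspace TX = carrier X" using semitopological_moduleD(2)[OF assms(2)] .
  have i: "continuous_map TX TM i"
    using assms(4) by (simp add: free_semitopological_module_def)
  have "universal_wrt TYPE('x) R TR TX M TM i"
    by (rule free_semitopological_module_universal[OF assms(1,4)])
  then have "\<exists>!g. g \<in> extensional (carrier M) \<and> g \<in> left_module_hom R M X \<and>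
      continuous_map TM TX g \<and> (\<forall>x\<in>topspace TX. g (i x) = id x)"
    using assms(2) continuous_map_id[of TX] unfolding universal_wrt_def by blast
  then obtain g where g: "g \<in> left_module_hom R M X" "continuous_map TM TX g"
    and gi: "\<And>x. x \<in> carrier X \<Longrightarrow> g (i x) = x"
    by (auto simp: tX)
  have "topological_module R TR X TX"
    using topological_module_retract[OF assms(2) M R i g gi] .
  with assms(3) show False ..
qed

end
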